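(* For every integer $n\geq 1$, $$\sum_{T\in\mathcal{B}_n}(xy)^{M(T)}\left(\frac{x+y}{2}\right)^{n-2M(T)-1}\alpha^{N_\alpha(T)}\beta^{N_\beta(T)}=\sum_{P\in\mathcal{P}_n}w(P),$$ where $\mathcal{B}_n$ is the set of increasing binary trees on $[n]$, $\mathcal{P}_n$ is the set of forests of planted increasing 0-1-2-plane trees on $[2,n]=\{2,3,\dots,n\}$, and the weight $w(P)$ of $P\in\mathcal{P}_n$ is the product of the following vertex labels: a single root is labeled $(x+y)\frac{\alpha+\beta}{2}$; the root of a component with at least two vertices is labeled $\alpha+\beta$; a non-root vertex with exactly one child is labeled $x+y$; a leaf (non-root vertex with no children) is labeled $xy$; a vertex with two children has label $1$.
   Context: An increasing binary tree on $[n]=\{1,\dots,n\}$ is a complete (full) rooted binary tree whose internal vertices are labeled bijectively by $[n]$, such that every internal vertex has exactly one left child and one right child, each being either an internal vertex or an (unlabeled, external) leaf, and such that labels of internal vertices increase along every path going away from the root. In such a tree $T$, the $a$-leaf is the leaf reached from the root by always moving to the left child, and the $b$-leaf is the leaf reached from the root by always moving to the right child. A leaf is proper if it is neither the $a$-leaf nor the $b$-leaf. An $\alpha$-vertex is an internal vertex other than the root lying on the path from the root to the $a$-leaf; a $\beta$-vertex is an internal vertex other than the root lying on the path from the root to the $b$-leaf. $N_\alpha(T)$ and $N_\beta(T)$ are the numbers of $\alpha$-vertices and $\beta$-vertices of $T$. $M(T)$ is the number of internal vertices of $T$ both of whose children are proper leaves. An increasing 0-1-2-plane tree on a nonempty finite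 set $V$ of integers is a rooted plane tree whose vertices are labeled bijectively by $V$, in which every vertex has $0$, $1$ or $2$ children, the children of a vertex with two children are linearly ordered (left/right), a sole child carries no left/right distinction, and labels increase along every path going away from the root. A planted increasing 0-1-2-plane tree on a nonempty finite set $U$ is a root labeled $\min U$ which is either a single vertex (a single root, when $|U|=1$) or has exactly one child, this child being the root of an increasing 0-1-2-plane tree on $U\setminus\{\min U\}$. A forest of such trees on $[2,n]$ is an unordered collection of planted increasing 0-1-2-plane trees whose label sets partition $[2,n]$; for $n=1$ there is only the empty forest, of weight $1$. *)

theory Defs
  imports
    Complex_Main
    "HOL-Library.Tree"
    "HOL-Library.Sublist"
    "HOL-Library.Disjoint_Sets"
begin

section \<open>Increasing binary trees\<close>

(* In the type 'a tree the labelled vertices Node are the internal vertices and every Leaf is an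
   external leaf. The library predicate heap only demands weakly increasing labels along the paths
   away from the root; since the labels are distinct, they increase strictly. *)
definition increasing_binary_trees :: "nat \<Rightarrow> nat tree set" where
  "increasing_binary_trees n = {T. heap T \<and> distinct (inorder T) \<and> set_tree T = {1..n}}"

(* A vertex or a leaf is identified with the sequence of steps that leads to it from the root. *)
datatype step = ToLeft | ToRight

fun subtree_at :: "'a tree \<Rightarrow> step list \<Rightarrow> 'a tree option" where
  "subtree_at t [] = Some t"
| "subtree_at Leaf (s # p) = None"
| "subtree_at (Node l v r) (ToLeft # p) = subtree_at l p"
| "subtree_at (Node l v r) (ToRight # p) = subtree_at r p"

definition internal_vertices :: "'a tree \<Rightarrow> step list set" where
  "internal_vertices t = {p. \<exists>l v r. subtree_at t p = Some (Node l v r)}"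

definition leaves :: "'a tree \<Rightarrow> step list set" where
  "leaves t = {p. subtree_at t p = Some Leaf}"

fun a_leaf :: "'a tree \<Rightarrow> step list" where
  "a_leaf Leaf = []"
| "a_leaf (Node l v r) = ToLeft # a_leaf l"

fun b_leaf :: "'a tree \<Rightarrow> step list" where
  "b_leaf Leaf = []"
| "b_leaf (Node l v r) = ToRight # b_leaf r"

definition proper_leaves :: "'a tree \<Rightarrow> step list set" where
  "proper_leaves t = leaves t - {a_leaf t, b_leaf t}"

(* The vertices on the path from the root to p are exactly the prefixes of p. *)
definition alpha_vertices :: "'a tree \<Rightarrow> step list set" where
  "alpha_vertices t = {p \<in> internal_vertices t. p \<noteq> [] \<and> prefix p (a_leaf t)}"

definition beta_vertices :: "'a tree \<Rightarrow> step list set" where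
  "beta_vertices t = {p \<in> internal_vertices t. p \<noteq> [] \<and> prefix p (b_leaf t)}"

definition num_alpha :: "'a tree \<Rightarrow> nat" where
  "num_alpha t = card (alpha_vertices t)"

definition num_beta :: "'a tree \<Rightarrow> nat" where
  "num_beta t = card (beta_vertices t)"

(* A tree with n \<ge> 1 internal vertices has n - 1 proper leaves, and the vertices counted here use
   disjoint pairs of them. Hence 2 * num_M t + 1 \<le> n, and the natural number subtraction
   n - 2 * num_M t - 1 never truncates. *)
definition num_M :: "'a tree \<Rightarrow> nat" where
  "num_M t = card {p \<in> internal_vertices t.
     p @ [ToLeft] \<in> proper_leaves t \<and> p @ [ToRight] \<in> proper_leaves t}"

section \<open>Planted increasing 0-1-2-plane trees\<close>

(* V0, V1, V2: a root with no, one, two (ordered: left, right) children. *)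
datatype 'a tree012 = V0 'a | V1 'a "'a tree012" | V2 'a "'a tree012" "'a tree012"

fun labels012 :: "'a tree012 \<Rightarrow> 'a list" where
  "labels012 (V0 v) = [v]"
| "labels012 (V1 v s) = v # labels012 s"
| "labels012 (V2 v l r) = v # labels012 l @ labels012 r"

fun increasing012 :: "'a::linorder tree012 \<Rightarrow> bool" where
  "increasing012 (V0 v) = True"
| "increasing012 (V1 v s) = ((\<forall>u \<in> set_tree012 s. v < u) \<and> increasing012 s)"
| "increasing012 (V2 v l r) =
     ((\<forall>u \<in> set_tree012 l \<union> set_tree012 r. v < u) \<and> increasing012 l \<and> increasing012 r)"

definition increasing_tree012_on :: "'a::linorder set \<Rightarrow> 'a tree012 \<Rightarrow> bool" where
  "increasing_tree012_on V t \<longleftrightarrow>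
     set_tree012 t = V \<and> distinct (labels012 t) \<and> increasing012 t"

datatype 'a planted = Single 'a | Planted 'a "'a tree012"

fun planted_on :: "'a::linorder set \<Rightarrow> 'a planted \<Rightarrow> bool" where
  "planted_on U (Single v) \<longleftrightarrow> U = {v}"
| "planted_on U (Planted v s) \<longleftrightarrow>
     v \<in> U \<and> v = Min U \<and> increasing_tree012_on (U - {Min U}) s"

(* The label sets of the components are nonempty and pairwise disjoint, so no tree can occur twice
   and an unordered collection of components is a set. Injectivity of set_planted is needed because
   partition_on only sees the set of label sets. *)
definition planted_forests_on :: "'a::linorder set \<Rightarrow> 'a planted set set" where
  "planted_forests_on A = {P.
     (\<forall>t \<in> P. planted_on (set_planted t) t) \<and>
     inj_on set_planted P \<and>
     partition_on A (set_planted ` P)}"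

fun weight012 :: "'k::field_char_0 \<Rightarrow> 'k \<Rightarrow> 'a tree012 \<Rightarrow> 'k" where
  "weight012 x y (V0 v) = x * y"
| "weight012 x y (V1 v s) = (x + y) * weight012 x y s"
| "weight012 x y (V2 v l r) = 1 * weight012 x y l * weight012 x y r"

fun planted_weight :: "'k::field_char_0 \<Rightarrow> 'k \<Rightarrow> 'k \<Rightarrow> 'k \<Rightarrow> 'a planted \<Rightarrow> 'k" where
  "planted_weight x y \<alpha> \<beta> (Single v) = (x + y) * ((\<alpha> + \<beta>) / 2)"
| "planted_weight x y \<alpha> \<beta> (Planted v s) = (\<alpha> + \<beta>) * weight012 x y s"

definition forest_weight ::
  "'k::field_char_0 \<Rightarrow> 'k \<Rightarrow> 'k \<Rightarrow> 'k \<Rightarrow> 'a planted set \<Rightarrow> 'k" where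
  "forest_weight x y \<alpha> \<beta> P = (\<Prod>t\<in>P. planted_weight x y \<alpha> \<beta> t)"

end

theory Submission
  imports Defs
begin

text \<open>Put \<open>s = (x + y) / 2\<close> and give each proper leaf outside a cherry the weight \<open>s\<close>, each cherry the
  weight \<open>x y\<close>. Let \<open>C\<close>, \<open>A\<close>, \<open>B\<close> be the weighted sums over the trees that may occur, respectively, at
  a generic place, as left subtree and as right subtree of the root, regarded as functions of the
  label set. Splitting off the minimal label, a derivation \<open>'\<close> for subset convolution, gives
  \<open>A' = \<alpha> A * C\<close> and \<open>B' = \<beta> B * C\<close>, so \<open>G = A * B\<close>, the left-hand side, satisfies
  \<open>G' = (\<alpha> + \<beta>) C * G\<close> and \<open>G {} = 1\<close>. On nonempty sets \<open>C\<close> is also the weighted sum over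
  0-1-2-plane trees, and \<open>C {} = s\<close> accounts for single roots; hence removing the component of the
  minimal label from a forest yields the same recursion.\<close>

section \<open>Subset convolution\<close>

text \<open>The product of set functions that corresponds to multiplying exponential generating
  functions; keeping actual label sets avoids relabelling and binomial coefficients.\<close>

definition subset_conv :: "('a set \<Rightarrow> 'k::comm_semiring_1) \<Rightarrow> ('a set \<Rightarrow> 'k) \<Rightarrow> 'a set \<Rightarrow> 'k" where
  "subset_conv f g V = (\<Sum>S\<in>Pow V. f S * g (V - S))"

lemma subset_conv_empty [simp]: "subset_conv f g {} = f {} * g {}"
  by (simp add: subset_conv_def)

lemma subset_conv_cong:
  assumes "\<And>S. S \<subseteq> V \<Longrightarrow> f S = f' S" "\<And>S. S \<subseteq> V \<Longrightarrow> g S = g' S"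
  shows "subset_conv f g V = subset_conv f' g' V"
  unfolding subset_conv_def using assms by (intro sum.cong) auto

lemma subset_conv_commute: "subset_conv f g V = subset_conv g f V"
  unfolding subset_conv_def
  by (rule sum.reindex_bij_witness[where i = "\<lambda>S. V - S" and j = "\<lambda>S. V - S"])
     (auto simp: double_diff mult.commute)

text \<open>Both sides sum over ordered splittings of \<open>V\<close> into three possibly empty
  blocks, encoded as (first two, first) or as (first, second).\<close>

lemma subset_conv_assoc:
  assumes "finite V"
  shows "subset_conv (subset_conv f g) h V = subset_conv f (subset_conv g h) V"
proof -
  have fin: "finite S" if "S \<subseteq> V" for S
    using assms that by (rule rev_finite_subset)
  have "subset_conv (subset_conv f g) h V
      = (\<Sum>(S, R)\<in>(SIGMA S:Pow V. Pow S). f R * g (S - R) * h (V - S))"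
    unfolding subset_conv_def sum_distrib_right
    using assms fin by (subst sum.Sigma) auto
  also have "\<dots> = (\<Sum>(R, Q)\<in>(SIGMA R:Pow V. Pow (V - R)). f R * (g Q * h (V - R - Q)))"
    by (rule sum.reindex_bij_witness
          [where i = "\<lambda>(R, Q). (R \<union> Q, R)" and j = "\<lambda>(S, R). (R, S - R)"])
       (auto simp: mult.assoc intro!: arg_cong[where f = "(*) _"] arg_cong[where f = h])
  also have "\<dots> = subset_conv f (subset_conv g h) V"
    unfolding subset_conv_def sum_distrib_left
    using assms fin by (subst sum.Sigma) auto
  finally show ?thesis .
qed

lemma subset_conv_scale_left:
  "subset_conv (\<lambda>S. c * f S) g V = c * subset_conv f g V"
  by (simp add: subset_conv_def sum_distrib_left mult.assoc)

lemma subset_conv_scale_right: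
  "subset_conv f (\<lambda>S. c * g S) V = c * subset_conv f g V"
  by (simp add: subset_conv_def sum_distrib_left mult.left_commute)

text \<open>The product rule, \<open>f (insert m S)\<close> playing the role of a derivative of \<open>f\<close> at \<open>S\<close>.\<close>
lemma subset_conv_insert:
  assumes "finite V" "m \<notin> V"
  shows "subset_conv f g (insert m V)
       = subset_conv (\<lambda>S. f (insert m S)) g V + subset_conv f (\<lambda>S. g (insert m S)) V"
proof -
  have inj: "inj_on (insert m) (Pow V)"
    using assms(2) by (auto intro!: inj_onI)
  have disj: "Pow V \<inter> insert m ` Pow V = {}"
    using assms(2) by auto
  have "subset_conv f g (insert m V) = (\<Sum>S\<in>Pow V. f S * g (insert m V - S))
      + (\<Sum>S\<in>Pow V. f (insert m S) * g (insert m V - insert m S))"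
    unfolding subset_conv_def Pow_insert using assms(1) inj disj
    by (simp add: sum.union_disjoint sum.reindex)
  also have "(\<Sum>S\<in>Pow V. f S * g (insert m V - S)) = subset_conv f (\<lambda>S. g (insert m S)) V"
    unfolding subset_conv_def using assms(2)
    by (intro sum.cong refl arg_cong2[where f = "(*)"] arg_cong[where f = g]) auto
  also have "(\<Sum>S\<in>Pow V. f (insert m S) * g (insert m V - insert m S))
      = subset_conv (\<lambda>S. f (insert m S)) g V"
    unfolding subset_conv_def using assms(2)
    by (intro sum.cong refl arg_cong2[where f = "(*)"] arg_cong[where f = g]) auto
  finally show ?thesis by (simp add: add.commute)
qed

text \<open>Isolates the terms with an empty argument, which are distinct because \<open>V\<close>
  is nonempty.\<close>

lemma subset_conv_split_trivial:
  assumes "finite V" "V \<noteq> {}"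
  shows "subset_conv f g V
       = f {} * g V + f V * g {} + (\<Sum>S\<in>Pow V - {{}, V}. f S * g (V - S))"
proof -
  have "subset_conv f g V
      = (\<Sum>S\<in>{{}, V}. f S * g (V - S)) + (\<Sum>S\<in>Pow V - {{}, V}. f S * g (V - S))"
    unfolding subset_conv_def using assms by (subst sum.subset_diff[of "{{}, V}"]) (auto simp: add.commute)
  then show ?thesis using assms by auto
qed

text \<open>The bridge from decompositions to convolutions: injectivity of \<open>k\<close> says
  that a structure determines its two parts, and the last assumption that weights multiply.\<close>

lemma sum_image_Sigma_eq_subset_conv:
  assumes "finite V"
    and "\<And>S. S \<subseteq> V \<Longrightarrow> finite (A S)" "\<And>S. S \<subseteq> V \<Longrightarrow> finite (B S)"
    and "inj_on k (SIGMA S:Pow V. A S \<times> B (V - S))"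
    and "\<And>S a b. S \<subseteq> V \<Longrightarrow> a \<in> A S \<Longrightarrow> b \<in> B (V - S) \<Longrightarrow> h (k (S, a, b)) = f a * g b"
  shows "sum h (k ` (SIGMA S:Pow V. A S \<times> B (V - S)))
       = subset_conv (\<lambda>S. sum f (A S)) (\<lambda>S. sum g (B S)) V"
proof -
  have "sum h (k ` (SIGMA S:Pow V. A S \<times> B (V - S)))
      = (\<Sum>(S, a, b)\<in>(SIGMA S:Pow V. A S \<times> B (V - S)). f a * g b)"
    using assms(4,5) by (subst sum.reindex) (auto intro!: sum.cong)
  also have "\<dots> = (\<Sum>S\<in>Pow V. \<Sum>(a, b)\<in>A S \<times> B (V - S). f a * g b)"
    using assms(1-3) by (subst sum.Sigma) auto
  also have "\<dots> = subset_conv (\<lambda>S. sum f (A S)) (\<lambda>S. sum g (B S)) V"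
    unfolding subset_conv_def by (simp add: sum_product sum.cartesian_product)
  finally show ?thesis .
qed

text \<open>A convolution at \<open>V\<close> involves every subset of \<open>V\<close>, so the
  induction hypothesis has to cover all of them.\<close>

lemma finite_min_induct [consumes 1, case_names empty insert]:
  fixes V :: "'a::linorder set"
  assumes "finite V" "P {}"
    and "\<And>m V. finite V \<Longrightarrow> \<forall>v\<in>V. m < v \<Longrightarrow> (\<And>S. S \<subseteq> V \<Longrightarrow> P S) \<Longrightarrow> P (insert m V)"
  shows "P V"
  using assms(1)
proof (induction V rule: finite_psubset_induct)
  case (psubset V)
  show ?case
  proof (cases "V = {}")
    case False
    define m where "m = Min V"
    have V: "V = insert m (V - {m})" and lt: "\<forall>v\<in>V - {m}. m < v"
      using Min_in[OF psubset.hyps False] Min_le[OF psubset.hyps]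
      by (auto simp: m_def order.strict_iff_order)
    have "P S" if "S \<subseteq> V - {m}" for S
      using that V by (intro psubset.IH) blast
    then show ?thesis
      using assms(3)[of "V - {m}" m] lt psubset.hyps V by simp
  qed (simp add: assms(2))
qed

section \<open>Increasing binary trees\<close>

text \<open>Arbitrary label sets are allowed because subtrees do not carry initial segments.\<close>

definition heap_trees :: "'a::linorder set \<Rightarrow> 'a tree set" where
  "heap_trees V = {T. heap T \<and> distinct (inorder T) \<and> set_tree T = V}"

lemma heap_trees_empty [simp]: "heap_trees {} = {Leaf}"
  by (auto simp: heap_trees_def)

lemma heap_trees_insert:
  assumes "\<forall>v\<in>V. m < v"
  shows "heap_trees (insert m V)
       = (\<lambda>(S, l, r). Node l m r) ` (SIGMA S:Pow V. heap_trees S \<times> heap_trees (V - S))"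
    (is "_ = ?k ` ?A")
proof (intro equalityI subsetI)
  fix T assume T: "T \<in> heap_trees (insert m V)"
  then obtain l v r where T_eq: "T = Node l v r"
    by (cases T) (auto simp: heap_trees_def)
  have h: "\<forall>u\<in>set_tree l \<union> set_tree r. v \<le> u" "heap l" "heap r"
      "distinct (inorder l)" "distinct (inorder r)" "set_tree l \<inter> set_tree r = {}"
      "v \<notin> set_tree l \<union> set_tree r" "insert v (set_tree l \<union> set_tree r) = insert m V"
    using T by (auto simp: T_eq heap_trees_def)
  \<comment> \<open>Both are least elements of the same label set.\<close>
  have "v = m"
    using h(1,8) assms by (metis insertE insertI1 leD)
  moreover have "set_tree l \<union> set_tree r = V"
    using h(7,8) assms \<open>v = m\<close> by (metis insert_ident less_irrefl)
  ultimately have "T = ?k (set_tree l, l, r)" "(set_tree l, l, r) \<in> ?A"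
    using h by (auto simp: T_eq heap_trees_def)
  then show "T \<in> ?k ` ?A" by (rule image_eqI)
next
  fix T assume "T \<in> ?k ` ?A"
  then show "T \<in> heap_trees (insert m V)"
    using assms by (fastforce simp: heap_trees_def)
qed

lemma finite_heap_trees: "finite V \<Longrightarrow> finite (heap_trees V)"
proof (induction V rule: finite_min_induct)
  case (insert m V)
  then show ?case
    by (auto simp: heap_trees_insert intro!: finite_SigmaI finite_cartesian_product)
qed simp

text \<open>Three weights are needed since the two children may be weighted differently from the
  root. Restricting the factorization to label union \<open>V\<close> lets a nonempty
  \<open>V\<close> rule out the one-vertex tree.\<close>

lemma sum_heap_trees_insert:
  assumes "finite V" "\<forall>v\<in>V. m < v"
    and "\<And>l r. set_tree l \<union> set_tree r = V \<Longrightarrow> h (Node l m r) = f l * g r"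
  shows "sum h (heap_trees (insert m V))
       = subset_conv (\<lambda>S. sum f (heap_trees S)) (\<lambda>S. sum g (heap_trees S)) V"
  unfolding heap_trees_insert[OF assms(2)]
proof (rule sum_image_Sigma_eq_subset_conv)
  show "inj_on (\<lambda>(S, l, r). Node l m r) (SIGMA S:Pow V. heap_trees S \<times> heap_trees (V - S))"
    by (auto simp: inj_on_def heap_trees_def)
  fix S l r assume "S \<subseteq> V" "l \<in> heap_trees S" "r \<in> heap_trees (V - S)"
  then show "h (case (S, l, r) of (S, l, r) \<Rightarrow> Node l m r) = f l * g r"
    using assms(3)[of l r] by (auto simp: heap_trees_def)
qed (use assms(1) in \<open>auto intro: finite_heap_trees finite_subset\<close>)

section \<open>Leaf statistics\<close>

text \<open>\<open>X\<close> is a set of forbidden leaves, so that one recursion serves the counts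
  avoiding no leaf, the a-leaf, the b-leaf, or both.\<close>

definition cherries :: "'a tree \<Rightarrow> step list set \<Rightarrow> step list set" where
  "cherries t X = {p \<in> internal_vertices t.
     p @ [ToLeft] \<in> leaves t - X \<and> p @ [ToRight] \<in> leaves t - X}"

lemma internal_vertices_Leaf [simp]: "internal_vertices Leaf = {}"
proof -
  have "subtree_at Leaf p \<noteq> Some (Node l v r)" for p and l :: "'a tree" and v r
    by (cases p) auto
  then show ?thesis by (auto simp: internal_vertices_def)
qed

lemma internal_vertices_Node_simps [simp]:
  "[] \<in> internal_vertices (Node l v r)"
  "ToLeft # p \<in> internal_vertices (Node l v r) \<longleftrightarrow> p \<in> internal_vertices l"
  "ToRight # p \<in> internal_vertices (Node l v r) \<longleftrightarrow> p \<in> internal_vertices r"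
  by (auto simp: internal_vertices_def)

lemma leaves_simps [simp]:
  "[] \<in> leaves t \<longleftrightarrow> t = Leaf"
  "ToLeft # p \<in> leaves (Node l v r) \<longleftrightarrow> p \<in> leaves l"
  "ToRight # p \<in> leaves (Node l v r) \<longleftrightarrow> p \<in> leaves r"
  by (auto simp: leaves_def)

lemma cherries_Leaf [simp]: "cherries Leaf X = {}"
  by (simp add: cherries_def)

lemma cherries_Node:
  "cherries (Node l v r) X =
     (if l = Leaf \<and> r = Leaf \<and> [ToLeft] \<notin> X \<and> [ToRight] \<notin> X then {[]} else {})
     \<union> (#) ToLeft ` cherries l {p. ToLeft # p \<in> X} \<union> (#) ToRight ` cherries r {p. ToRight # p \<in> X}"
  (is "?A = ?B")
proof (rule set_eqI)
  fix p
  show "p \<in> ?A \<longleftrightarrow> p \<in> ?B"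
  proof (cases p)
    case (Cons s q)
    then show ?thesis by (cases s) (auto simp: cherries_def)
  qed (auto simp: cherries_def)
qed

lemma finite_cherries [simp]: "finite (cherries t X)"
  by (induction t arbitrary: X) (auto simp: cherries_Node)

lemma card_cherries_Node:
  "card (cherries (Node l v r) X) =
     (if l = Leaf \<and> r = Leaf \<and> [ToLeft] \<notin> X \<and> [ToRight] \<notin> X then 1
      else card (cherries l {p. ToLeft # p \<in> X}) + card (cherries r {p. ToRight # p \<in> X}))"
proof -
  have "card ((#) ToLeft ` A \<union> (#) ToRight ` B) = card A + card B" if "finite A" "finite B" for A B
    using that by (subst card_Un_disjoint) (auto simp: card_image)
  then show ?thesis by (auto simp: cherries_Node)
qed

definition num_cherries :: "'a tree \<Rightarrow> nat" where
  "num_cherries t = card (cherries t {})"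

definition num_cherries_a :: "'a tree \<Rightarrow> nat" where
  "num_cherries_a t = card (cherries t {a_leaf t})"

definition num_cherries_b :: "'a tree \<Rightarrow> nat" where
  "num_cherries_b t = card (cherries t {b_leaf t})"

lemma num_cherries_simps [simp]:
  "num_cherries Leaf = 0"
  "num_cherries (Node l v r)
     = (if l = Leaf \<and> r = Leaf then 1 else num_cherries l + num_cherries r)"
  by (auto simp: num_cherries_def card_cherries_Node)

text \<open>The root never counts: if its left child is a leaf, that is the a-leaf. No leaf of the
  right subtree is forbidden.\<close>

lemma num_cherries_a_simps [simp]:
  "num_cherries_a Leaf = 0"
  "num_cherries_a (Node l v r) = num_cherries_a l + num_cherries r"
  by (auto simp: num_cherries_a_def num_cherries_def card_cherries_Node)

lemma num_cherries_b_simps [simp]: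
  "num_cherries_b Leaf = 0"
  "num_cherries_b (Node l v r) = num_cherries l + num_cherries_b r"
  by (auto simp: num_cherries_b_def num_cherries_def card_cherries_Node)

text \<open>The a-leaf lies on the left and the b-leaf on the right of the root, so each subtree has
  a single forbidden leaf, and the root cannot count.\<close>

lemma num_M_Node: "num_M (Node l v r) = num_cherries_a l + num_cherries_b r"
proof -
  have "num_M t = card (cherries t {a_leaf t, b_leaf t})" for t :: "'a tree"
    by (auto simp: num_M_def cherries_def proper_leaves_def intro!: arg_cong[where f = card])
  then show ?thesis
    by (auto simp: card_cherries_Node num_cherries_a_def num_cherries_b_def)
qed

text \<open>Cherries use disjoint pairs of the \<open>size t + 1\<close> leaves. This bound and the
  next two keep the exponents in the weights from truncating.\<close>

lemma num_cherries_le: "2 * num_cherries t \<le> size t + 1"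
  by (induction t) auto

lemma num_cherries_a_le: "2 * num_cherries_a t \<le> size t"
proof (induction t)
  case (Node l v r)
  then show ?case using num_cherries_le[of r] by simp
qed simp

lemma num_cherries_b_le: "2 * num_cherries_b t \<le> size t"
proof (induction t)
  case (Node l v r)
  then show ?case using num_cherries_le[of l] by simp
qed simp

section \<open>Spines and the numbers of alpha- and beta-vertices\<close>

fun left_spine :: "'a tree \<Rightarrow> nat" where
  "left_spine Leaf = 0"
| "left_spine (Node l v r) = Suc (left_spine l)"

fun right_spine :: "'a tree \<Rightarrow> nat" where
  "right_spine Leaf = 0"
| "right_spine (Node l v r) = Suc (right_spine r)"

lemma alpha_vertices_Node:
  "alpha_vertices (Node l v r) = (#) ToLeft ` {p \<in> internal_vertices l. prefix p (a_leaf l)}"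
proof (rule set_eqI)
  fix p show "p \<in> alpha_vertices (Node l v r)
      \<longleftrightarrow> p \<in> (#) ToLeft ` {p \<in> internal_vertices l. prefix p (a_leaf l)}"
    by (cases p) (auto simp: alpha_vertices_def)
qed

lemma beta_vertices_Node:
  "beta_vertices (Node l v r) = (#) ToRight ` {p \<in> internal_vertices r. prefix p (b_leaf r)}"
proof (rule set_eqI)
  fix p show "p \<in> beta_vertices (Node l v r)
      \<longleftrightarrow> p \<in> (#) ToRight ` {p \<in> internal_vertices r. prefix p (b_leaf r)}"
    by (cases p) (auto simp: beta_vertices_def)
qed

text \<open>Here the root of \<open>t\<close> counts, unlike in \<open>alpha_vertices\<close>:
  \<open>t\<close> will be the left child of the root of the whole tree. In the induction the root
  \<open>[]\<close> is put back, which yields the successor.\<close>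

lemma card_left_spine:
  "card {p \<in> internal_vertices t. prefix p (a_leaf t)} = left_spine t"
proof (induction t)
  case (Node l v r)
  have "{p \<in> internal_vertices (Node l v r). prefix p (a_leaf (Node l v r))}
      = insert [] (alpha_vertices (Node l v r))"
    by (auto simp: alpha_vertices_def)
  moreover have "finite {p \<in> internal_vertices l. prefix p (a_leaf l)}"
    by (rule finite_subset[of _ "set (prefixes (a_leaf l))"]) auto
  ultimately show ?case
    using Node.IH(1) by (simp add: alpha_vertices_Node card_image card_insert_if image_iff)
qed simp

lemma card_right_spine:
  "card {p \<in> internal_vertices t. prefix p (b_leaf t)} = right_spine t"
proof (induction t)
  case (Node l v r)
  have "{p \<in> internal_vertices (Node l v r). prefix p (b_leaf (Node l v r))}
      = insert [] (beta_vertices (Node l v r))"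
    by (auto simp: beta_vertices_def)
  moreover have "finite {p \<in> internal_vertices r. prefix p (b_leaf r)}"
    by (rule finite_subset[of _ "set (prefixes (b_leaf r))"]) auto
  ultimately show ?case
    using Node.IH(2) by (simp add: beta_vertices_Node card_image card_insert_if image_iff)
qed simp

lemma num_alpha_Node: "num_alpha (Node l v r) = left_spine l"
  by (simp add: num_alpha_def alpha_vertices_Node card_image card_left_spine)

lemma num_beta_Node: "num_beta (Node l v r) = right_spine r"
  by (simp add: num_beta_def beta_vertices_Node card_image card_right_spine)

section \<open>Multiplicative weights of binary trees\<close>

text \<open>Weighs \<open>k\<close> leaves of which \<open>2 * c\<close> are paired into
  cherries.\<close>

definition pair_weight :: "'k::field_char_0 \<Rightarrow> 'k \<Rightarrow> nat \<Rightarrow> nat \<Rightarrow> 'k" where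
  "pair_weight x y c k = (x * y) ^ c * ((x + y) / 2) ^ (k - 2 * c)"

lemma pair_weight_add:
  assumes "2 * c \<le> k" "2 * d \<le> j"
  shows "pair_weight x y (c + d) (k + j) = pair_weight x y c k * pair_weight x y d j"
proof -
  have "k + j - 2 * (c + d) = (k - 2 * c) + (j - 2 * d)"
    using assms by simp
  then show ?thesis by (simp add: pair_weight_def power_add)
qed

text \<open>The exponent of \<open>(x + y) / 2\<close> counts the leaves outside cherries, so these weights are
  products over subtrees. A tree with \<open>size t\<close> inner vertices has \<open>size t + 1\<close> leaves; the \<open>a\<close>- and \<open>b\<close>-weights leave
  out the leftmost, resp. the rightmost, one.\<close>
definition leaf_weight :: "'k::field_char_0 \<Rightarrow> 'k \<Rightarrow> 'a tree \<Rightarrow> 'k" where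
  "leaf_weight x y t = pair_weight x y (num_cherries t) (size t + 1)"

definition leaf_weight_a :: "'k::field_char_0 \<Rightarrow> 'k \<Rightarrow> 'k \<Rightarrow> 'a tree \<Rightarrow> 'k" where
  "leaf_weight_a x y \<alpha> t = pair_weight x y (num_cherries_a t) (size t) * \<alpha> ^ left_spine t"

definition leaf_weight_b :: "'k::field_char_0 \<Rightarrow> 'k \<Rightarrow> 'k \<Rightarrow> 'a tree \<Rightarrow> 'k" where
  "leaf_weight_b x y \<beta> t = pair_weight x y (num_cherries_b t) (size t) * \<beta> ^ right_spine t"

text \<open>The one-vertex tree is the only exception to multiplicativity: its two leaves form a
  cherry.\<close>

lemma leaf_weight_simps:
  "leaf_weight x y Leaf = (x + y) / 2"
  "leaf_weight x y (Node Leaf v Leaf) = x * y"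
  "l \<noteq> Leaf \<or> r \<noteq> Leaf \<Longrightarrow> leaf_weight x y (Node l v r) = leaf_weight x y l * leaf_weight x y r"
  using pair_weight_add[OF num_cherries_le num_cherries_le, of x y l r]
  by (auto simp: leaf_weight_def) (auto simp: pair_weight_def)

text \<open>No exception here, since a spine vertex is never a counted cherry. The value at
  \<open>Leaf\<close> is 1 because its only leaf is the a-leaf.\<close>

lemma leaf_weight_a_simps:
  "leaf_weight_a x y \<alpha> Leaf = 1"
  "leaf_weight_a x y \<alpha> (Node l v r) = \<alpha> * (leaf_weight_a x y \<alpha> l * leaf_weight x y r)"
  using pair_weight_add[OF num_cherries_a_le num_cherries_le, of x y l r]
  by (auto simp: leaf_weight_def leaf_weight_a_def) (auto simp: pair_weight_def)

lemma leaf_weight_b_simps: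
  "leaf_weight_b x y \<beta> Leaf = 1"
  "leaf_weight_b x y \<beta> (Node l v r) = \<beta> * (leaf_weight x y l * leaf_weight_b x y \<beta> r)"
  using pair_weight_add[OF num_cherries_le num_cherries_b_le, of x y l r]
  by (auto simp: leaf_weight_def leaf_weight_b_def) (auto simp: pair_weight_def)

text \<open>The \<open>size T - 1 = size l + size r\<close> proper leaves are those of
  \<open>l\<close> without its a-leaf and those of \<open>r\<close> without its b-leaf, so the
  summand splits.\<close>

lemma tree_weight_Node:
  fixes l r :: "'a tree" and v :: 'a and x y \<alpha> \<beta> :: "'k::field_char_0"
  defines "T \<equiv> Node l v r"
  shows "(x * y) ^ num_M T * ((x + y) / 2) ^ (size T - 2 * num_M T - 1)
           * \<alpha> ^ num_alpha T * \<beta> ^ num_beta T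
       = leaf_weight_a x y \<alpha> l * leaf_weight_b x y \<beta> r"
proof -
  have "(x * y) ^ num_M T * ((x + y) / 2) ^ (size T - 2 * num_M T - 1)
      = pair_weight x y (num_cherries_a l + num_cherries_b r) (size l + size r)"
    by (simp add: T_def num_M_Node pair_weight_def)
  also have "\<dots> = pair_weight x y (num_cherries_a l) (size l)
      * pair_weight x y (num_cherries_b r) (size r)"
    by (intro pair_weight_add num_cherries_a_le num_cherries_b_le)
  finally show ?thesis
    by (simp add: T_def num_alpha_Node num_beta_Node leaf_weight_a_def leaf_weight_b_def)
qed

text \<open>\<open>leaf_sum\<close>, \<open>leaf_sum_a\<close> and \<open>leaf_sum_b\<close> are the
  functions C, A and B of the overview.\<close>

definition leaf_sum :: "'k::field_char_0 \<Rightarrow> 'k \<Rightarrow> 'a::linorder set \<Rightarrow> 'k" where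
  "leaf_sum x y V = sum (leaf_weight x y) (heap_trees V)"

definition leaf_sum_a :: "'k::field_char_0 \<Rightarrow> 'k \<Rightarrow> 'k \<Rightarrow> 'a::linorder set \<Rightarrow> 'k" where
  "leaf_sum_a x y \<alpha> V = sum (leaf_weight_a x y \<alpha>) (heap_trees V)"

definition leaf_sum_b :: "'k::field_char_0 \<Rightarrow> 'k \<Rightarrow> 'k \<Rightarrow> 'a::linorder set \<Rightarrow> 'k" where
  "leaf_sum_b x y \<beta> V = sum (leaf_weight_b x y \<beta>) (heap_trees V)"

lemma leaf_sum_empty: "leaf_sum x y {} = (x + y) / 2"
  by (simp add: leaf_sum_def leaf_weight_simps)

lemma leaf_sum_singleton: "leaf_sum x y {m} = x * y"
proof -
  have "heap_trees {m} = {Node Leaf m Leaf}"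
    by (subst heap_trees_insert) (auto simp: image_iff)
  then show ?thesis by (simp add: leaf_sum_def leaf_weight_simps)
qed

text \<open>For empty \<open>V\<close> the right side would be the square of
  \<open>(x + y) / 2\<close> instead of the cherry weight \<open>x * y\<close>.\<close>

lemma leaf_sum_insert:
  assumes "finite V" "\<forall>v\<in>V. m < v" "V \<noteq> {}"
  shows "leaf_sum x y (insert m V) = subset_conv (leaf_sum x y) (leaf_sum x y) V"
  unfolding leaf_sum_def
  by (rule sum_heap_trees_insert[OF assms(1,2)]) (use assms(3) in \<open>auto intro!: leaf_weight_simps\<close>)

lemma leaf_sum_a_insert:
  assumes "finite V" "\<forall>v\<in>V. m < v"
  shows "leaf_sum_a x y \<alpha> (insert m V) = \<alpha> * subset_conv (leaf_sum_a x y \<alpha>) (leaf_sum x y) V"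
  unfolding leaf_sum_def leaf_sum_a_def subset_conv_scale_left[symmetric] sum_distrib_left
  by (rule sum_heap_trees_insert[OF assms]) (simp add: leaf_weight_a_simps mult.assoc)

lemma leaf_sum_b_insert:
  assumes "finite V" "\<forall>v\<in>V. m < v"
  shows "leaf_sum_b x y \<beta> (insert m V) = \<beta> * subset_conv (leaf_sum x y) (leaf_sum_b x y \<beta>) V"
  unfolding leaf_sum_def leaf_sum_b_def subset_conv_scale_left[symmetric] sum_distrib_left
  by (rule sum_heap_trees_insert[OF assms]) (simp add: leaf_weight_b_simps mult.assoc)

lemma subset_conv_leaf_sums_insert:
  fixes V :: "'a::linorder set"
  defines "G \<equiv> \<lambda>x y \<alpha> \<beta>. subset_conv (leaf_sum_a x y \<alpha> :: 'a set \<Rightarrow> _) (leaf_sum_b x y \<beta>)"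
  assumes "finite V" "\<forall>v\<in>V. m < v"
  shows "G x y \<alpha> \<beta> (insert m V) = (\<alpha> + \<beta>) * subset_conv (leaf_sum x y) (G x y \<alpha> \<beta>) V"
proof -
  let ?C = "leaf_sum x y" and ?A = "leaf_sum_a x y \<alpha>" and ?B = "leaf_sum_b x y \<beta>"
  \<comment> \<open>The recursions for A and B are applied inside a convolution, hence at every
    subset of \<open>V\<close>.\<close>
  have sub: "finite S \<and> (\<forall>v\<in>S. m < v)" if "S \<subseteq> V" for S
    using assms(2,3) that finite_subset by blast
  have "G x y \<alpha> \<beta> (insert m V)
      = subset_conv (\<lambda>S. ?A (insert m S)) ?B V + subset_conv ?A (\<lambda>S. ?B (insert m S)) V"
    unfolding G_def using assms(2,3) by (intro subset_conv_insert) auto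
  also have "subset_conv (\<lambda>S. ?A (insert m S)) ?B V
      = subset_conv (\<lambda>S. \<alpha> * subset_conv ?C ?A S) ?B V"
    using sub by (intro subset_conv_cong) (auto simp: leaf_sum_a_insert subset_conv_commute)
  also have "\<dots> = \<alpha> * subset_conv ?C (subset_conv ?A ?B) V"
    using assms(2) by (simp add: subset_conv_scale_left subset_conv_assoc)
  also have "subset_conv ?A (\<lambda>S. ?B (insert m S)) V
      = subset_conv ?A (\<lambda>S. \<beta> * subset_conv ?B ?C S) V"
    using sub by (intro subset_conv_cong) (auto simp: leaf_sum_b_insert subset_conv_commute)
  also have "\<dots> = \<beta> * subset_conv (subset_conv ?A ?B) ?C V"
    using assms(2) by (simp add: subset_conv_scale_right subset_conv_assoc)
  also have "\<dots> = \<beta> * subset_conv ?C (subset_conv ?A ?B) V"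
    by (simp add: subset_conv_commute)
  finally show ?thesis by (simp add: G_def distrib_right)
qed

section \<open>Increasing 0-1-2-plane trees\<close>

lemma set_labels012 [simp]: "set (labels012 t) = set_tree012 t"
  by (induction t) auto

lemma set_tree012_nonempty [simp]: "set_tree012 t \<noteq> {}"
  by (cases t) auto

definition trees012 :: "'a::linorder set \<Rightarrow> 'a tree012 set" where
  "trees012 V = {t. increasing_tree012_on V t}"

lemma trees012_empty [simp]: "trees012 {} = {}"
  by (auto simp: trees012_def increasing_tree012_on_def)

lemma trees012_singleton [simp]: "trees012 {m} = {V0 m}"
proof -
  have "t = V0 m" if "t \<in> trees012 {m}" for t
  proof (cases t)
    case (V1 v s)
    then have "set_tree012 s \<subseteq> {m}" "v = m" "v \<notin> set_tree012 s"
      using that by (auto simp: trees012_def increasing_tree012_on_def)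
    then show ?thesis using set_tree012_nonempty[of s] by blast
  next
    case (V2 v l r)
    then have "set_tree012 l \<subseteq> {m}" "v = m" "v \<notin> set_tree012 l"
      using that by (auto simp: trees012_def increasing_tree012_on_def)
    then show ?thesis using set_tree012_nonempty[of l] by blast
  qed (use that in \<open>auto simp: trees012_def increasing_tree012_on_def\<close>)
  then show ?thesis by (auto simp: trees012_def increasing_tree012_on_def)
qed

text \<open>Since \<open>V\<close> is nonempty, the root \<open>m\<close> has one or two children.
  The choices \<open>S = {}\<close> and \<open>S = V\<close> contribute nothing, as no tree has an
  empty label set.\<close>

lemma trees012_insert:
  assumes "\<forall>v\<in>V. m < v" "V \<noteq> {}"
  shows "trees012 (insert m V) = V1 m ` trees012 V
     \<union> (\<lambda>(S, l, r). V2 m l r) ` (SIGMA S:Pow V. trees012 S \<times> trees012 (V - S))"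
    (is "_ = ?B \<union> ?k ` ?A")
proof (intro equalityI subsetI)
  fix t assume t: "t \<in> trees012 (insert m V)"
  have root: "v = m \<and> U = V" if "insert v U = insert m V" "\<forall>u\<in>U. v < u" for v U
  proof -
    have "v = m" using that assms(1) by (metis insertE insertI1 less_asym)
    then show ?thesis using that assms(1) by (metis insert_ident less_irrefl)
  qed
  show "t \<in> ?B \<union> ?k ` ?A"
  proof (cases t)
    case (V0 v)
    then have "insert m V = {v}" using t by (auto simp: trees012_def increasing_tree012_on_def)
    then show ?thesis using assms by auto
  next
    case (V1 v s)
    then show ?thesis
      using t root[of v "set_tree012 s"] by (auto simp: trees012_def increasing_tree012_on_def)
  next
    case (V2 v l r)
    have "v = m \<and> set_tree012 l \<union> set_tree012 r = V"
      using t V2 by (intro root) (auto simp: trees012_def increasing_tree012_on_def)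
    then have "t = ?k (set_tree012 l, l, r)" "(set_tree012 l, l, r) \<in> ?A"
      using t by (auto simp: V2 trees012_def increasing_tree012_on_def)
    then show ?thesis by blast
  qed
next
  fix t assume "t \<in> ?B \<union> ?k ` ?A"
  then show "t \<in> trees012 (insert m V)"
    using assms by (fastforce simp: trees012_def increasing_tree012_on_def)
qed

lemma finite_trees012: "finite V \<Longrightarrow> finite (trees012 V)"
proof (induction V rule: finite_min_induct)
  case (insert m V)
  then show ?case
    by (cases "V = {}")
       (auto simp: trees012_insert intro!: finite_SigmaI finite_cartesian_product)
qed simp

definition sum012 :: "'k::field_char_0 \<Rightarrow> 'k \<Rightarrow> 'a::linorder set \<Rightarrow> 'k" where
  "sum012 x y V = sum (weight012 x y) (trees012 V)"

lemma sum012_insert: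
  assumes "finite V" "\<forall>v\<in>V. m < v" "V \<noteq> {}"
  shows "sum012 x y (insert m V)
       = (x + y) * sum012 x y V + subset_conv (sum012 x y) (sum012 x y) V"
proof -
  let ?k = "\<lambda>(S, l, r). V2 m l r" and ?A = "SIGMA S:Pow V. trees012 S \<times> trees012 (V - S)"
  have fin: "finite (trees012 S)" if "S \<subseteq> V" for S
    using assms(1) that by (auto intro: finite_trees012 finite_subset)
  have "sum012 x y (insert m V)
      = sum (weight012 x y) (V1 m ` trees012 V) + sum (weight012 x y) (?k ` ?A)"
    unfolding sum012_def trees012_insert[OF assms(2,3)]
    using assms(1) fin by (intro sum.union_disjoint) (auto intro!: finite_SigmaI)
  also have "sum (weight012 x y) (V1 m ` trees012 V) = (x + y) * sum012 x y V"
    by (subst sum.reindex) (auto simp: inj_on_def sum012_def sum_distrib_left)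
  also have "sum (weight012 x y) (?k ` ?A) = subset_conv (sum012 x y) (sum012 x y) V"
    unfolding sum012_def
    by (rule sum_image_Sigma_eq_subset_conv)
       (use assms(1) fin in \<open>auto simp: inj_on_def trees012_def increasing_tree012_on_def\<close>)
  finally show ?thesis .
qed

text \<open>The two terms of \<^term>\<open>subset_conv (leaf_sum x y) (leaf_sum x y) V\<close> in which one factor comes from
  the empty set, each \<open>(x + y) / 2\<close> times the other factor, add up to the contribution of a vertex
  with a sole child.\<close>
lemma sum012_eq_leaf_sum:
  "finite V \<Longrightarrow> V \<noteq> {} \<Longrightarrow> sum012 x y V = leaf_sum x y V"
proof (induction V rule: finite_min_induct)
  case (insert m V)
  show ?case
  proof (cases "V = {}")
    \<comment> \<open>A leaf of a 0-1-2-tree matches a cherry of a binary tree.\<close>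
    case True
    then show ?thesis by (simp add: sum012_def leaf_sum_singleton)
  next
    case False
    have IH: "sum012 x y S = leaf_sum x y S" if "S \<subseteq> V" "S \<noteq> {}" for S
      using insert.IH that by blast
    \<comment> \<open>\<open>sum012\<close> vanishes at the empty set, so the two trivial terms of
      its convolution are 0.\<close>
    have "sum012 x y (insert m V) = (x + y) * leaf_sum x y V
        + (\<Sum>S\<in>Pow V - {{}, V}. sum012 x y S * sum012 x y (V - S))"
      using insert.hyps False IH[of V]
      by (simp add: sum012_insert subset_conv_split_trivial) (simp add: sum012_def)
    also have "(\<Sum>S\<in>Pow V - {{}, V}. sum012 x y S * sum012 x y (V - S))
        = (\<Sum>S\<in>Pow V - {{}, V}. leaf_sum x y S * leaf_sum x y (V - S))"
      by (intro sum.cong refl arg_cong2[where f = "(*)"] IH) auto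
    also have "(x + y) * leaf_sum x y V + \<dots> = leaf_sum x y (insert m V)"
      using insert.hyps False
      by (simp add: leaf_sum_insert subset_conv_split_trivial leaf_sum_empty field_simps)
    finally show ?thesis .
  qed
qed simp

section \<open>Forests of planted trees\<close>

definition planted_trees :: "'a::linorder set \<Rightarrow> 'a planted set" where
  "planted_trees U = {t. planted_on U t}"

lemma set_planted_nonempty [simp]: "set_planted t \<noteq> {}"
  by (cases t) auto

lemma planted_on_set_planted: "planted_on U t \<Longrightarrow> set_planted t = U"
  by (cases t) (auto simp: increasing_tree012_on_def)

lemma planted_trees_insert:
  assumes "finite S" "\<forall>v\<in>S. m < v"
  shows "planted_trees (insert m S) = (if S = {} then {Single m} else Planted m ` trees012 S)"
proof -
  have min: "Min (insert m S) = m"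
    using assms by (intro Min_eqI) auto
  have diff: "insert m S - {m} = S"
    using assms(2) by auto
  have single: "planted_on (insert m S) (Single v) \<longleftrightarrow> S = {} \<and> v = m" for v
    using assms(2) by auto
  have planted: "planted_on (insert m S) (Planted v s) \<longleftrightarrow> v = m \<and> s \<in> trees012 S" for v s
    by (auto simp: min diff trees012_def)
  have "t \<in> planted_trees (insert m S)
      \<longleftrightarrow> t \<in> (if S = {} then {Single m} else Planted m ` trees012 S)" for t
    using single planted by (cases t) (auto simp: planted_trees_def simp del: planted_on.simps)
  then show ?thesis by blast
qed

lemma finite_planted_trees_insert:
  assumes "finite S" "\<forall>v\<in>S. m < v"
  shows "finite (planted_trees (insert m S))"
  using assms by (simp add: planted_trees_insert finite_trees012)

text \<open>For empty \<open>S\<close> the factor \<open>(x + y) / 2\<close> of a single root is the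
  value of \<open>leaf_sum\<close> at the empty set, so one formula covers both kinds of
  components.\<close>

lemma sum_planted_trees_insert:
  assumes "finite S" "\<forall>v\<in>S. m < v"
  shows "sum (planted_weight x y \<alpha> \<beta>) (planted_trees (insert m S)) = (\<alpha> + \<beta>) * leaf_sum x y S"
proof (cases "S = {}")
  case True
  then show ?thesis using assms by (simp add: planted_trees_insert leaf_sum_empty)
next
  case False
  then have "sum (planted_weight x y \<alpha> \<beta>) (planted_trees (insert m S))
      = (\<alpha> + \<beta>) * sum012 x y S"
    using assms by (simp add: planted_trees_insert sum.reindex inj_on_def sum012_def sum_distrib_left)
  then show ?thesis using assms False by (simp add: sum012_eq_leaf_sum)
qed

lemma planted_forests_on_empty [simp]: "planted_forests_on {} = {{}}"
  by (auto simp: planted_forests_on_def partition_on_def)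

lemma Union_planted_forest: "P \<in> planted_forests_on A \<Longrightarrow> (\<Union>t\<in>P. set_planted t) = A"
  by (auto simp: planted_forests_on_def partition_on_def)

text \<open>The label set of \<open>t\<close> has to be a new block of the partition: in one
  direction by injectivity, in the other because it is nonempty and disjoint from the remaining
  blocks.\<close>

lemma planted_forests_on_insert_iff:
  assumes "t \<notin> P"
  shows "insert t P \<in> planted_forests_on A \<longleftrightarrow>
    planted_on (set_planted t) t \<and> set_planted t \<subseteq> A \<and> P \<in> planted_forests_on (A - set_planted t)"
    (is "?L \<longleftrightarrow> ?R")
proof
  assume L: ?L
  then have inj: "inj_on set_planted (insert t P)"
    and part: "partition_on A (insert (set_planted t) (set_planted ` P))"
    by (auto simp: planted_forests_on_def)
  have "set_planted t \<notin> set_planted ` P"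
    using inj assms by (auto simp: inj_on_def)
  then have "disjnt (set_planted t) (\<Union>(set_planted ` P))"
    using part by (auto simp: partition_on_def disjoint_def disjnt_def)
  then have "partition_on (A - set_planted t) (set_planted ` P) \<and> set_planted t \<subseteq> A"
    using part by (simp add: partition_on_insert)
  then show ?R
    using L inj by (auto simp: planted_forests_on_def)
next
  assume R: ?R
  have disj: "disjnt (set_planted t) (\<Union>(set_planted ` P))"
    using R Union_planted_forest[of P "A - set_planted t"] by (auto simp: disjnt_def)
  then have "set_planted t \<notin> set_planted ` P"
    using set_planted_nonempty[of t] unfolding disjnt_def by blast
  with disj R show ?L
    by (auto simp: planted_forests_on_def partition_on_insert inj_on_insert)
qed

text \<open>The component containing \<open>m\<close> is singled out; \<open>S\<close> holds its
  other labels.\<close>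

lemma planted_forests_on_insert:
  assumes "m \<notin> V"
  shows "planted_forests_on (insert m V) = (\<lambda>(S, t, P). insert t P) `
     (SIGMA S:Pow V. planted_trees (insert m S) \<times> planted_forests_on (V - S))"
    (is "_ = ?k ` ?A")
proof (intro equalityI subsetI)
  fix Q assume Q: "Q \<in> planted_forests_on (insert m V)"
  then obtain t where t: "t \<in> Q" "m \<in> set_planted t"
    using Union_planted_forest[OF Q] by blast
  define S where "S = set_planted t - {m}"
  have St: "set_planted t = insert m S" "m \<notin> S"
    using t by (auto simp: S_def)
  have Q_eq: "Q = insert t (Q - {t})"
    using t by blast
  then have "insert t (Q - {t}) \<in> planted_forests_on (insert m V)"
    using Q by simp
  then have h: "planted_on (insert m S) t" "insert m S \<subseteq> insert m V"
      "Q - {t} \<in> planted_forests_on (insert m V - insert m S)"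
    by (subst (asm) planted_forests_on_insert_iff; simp add: St)+
  moreover have "insert m V - insert m S = V - S" "S \<subseteq> V"
    using assms h(2) St by auto
  ultimately have "(S, t, Q - {t}) \<in> ?A"
    by (simp add: planted_trees_def)
  moreover have "Q = ?k (S, t, Q - {t})"
    using Q_eq by simp
  ultimately show "Q \<in> ?k ` ?A" by (rule rev_image_eqI)
next
  fix Q assume "Q \<in> ?k ` ?A"
  then obtain S t P where Q: "Q = insert t P" "S \<subseteq> V" "planted_on (insert m S) t"
      "P \<in> planted_forests_on (V - S)"
    by (auto simp: planted_trees_def)
  have set_t: "set_planted t = insert m S"
    using Q(3) by (rule planted_on_set_planted)
  then have "t \<notin> P"
    using Union_planted_forest[OF Q(4)] assms by blast
  moreover have "insert m V - insert m S = V - S"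
    using assms by blast
  ultimately show "Q \<in> planted_forests_on (insert m V)"
    using Q set_t by (auto simp: planted_forests_on_insert_iff)
qed

lemma finite_planted_forests_on: "finite A \<Longrightarrow> finite (planted_forests_on A)"
proof (induction A rule: finite_min_induct)
  case (insert m V)
  have "finite (planted_trees (insert m S))" if "S \<subseteq> V" for S
    using insert.hyps that by (intro finite_planted_trees_insert) (auto intro: finite_subset)
  moreover have "m \<notin> V"
    using insert.hyps by auto
  ultimately show ?case
    using insert by (auto simp: planted_forests_on_insert intro!: finite_SigmaI)
qed simp

lemma sum_planted_forests_on_insert:
  fixes V :: "'a::linorder set"
  defines "F \<equiv> \<lambda>x y \<alpha> \<beta> A. sum (forest_weight x y \<alpha> \<beta>) (planted_forests_on (A :: 'a set))"
  assumes "finite V" "\<forall>v\<in>V. m < v"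
  shows "F x y \<alpha> \<beta> (insert m V) = (\<alpha> + \<beta>) * subset_conv (leaf_sum x y) (F x y \<alpha> \<beta>) V"
proof -
  let ?A = "SIGMA S:Pow V. planted_trees (insert m S) \<times> planted_forests_on (V - S)"
  have m: "m \<notin> V" using assms(3) by auto
  have sub: "finite S \<and> (\<forall>v\<in>S. m < v)" if "S \<subseteq> V" for S
    using assms(2,3) that finite_subset by blast
  \<comment> \<open>\<open>t\<close> contains \<open>m\<close>, which no component of
    \<open>P\<close> does. The sets \<open>S\<close> and \<open>R\<close> are independent so that
    two decompositions can be compared crosswise.\<close>
  have new: "t \<notin> P" if "t \<in> planted_trees (insert m S)" "P \<in> planted_forests_on (V - R)"
    for t P S R
    using that m planted_on_set_planted[of "insert m S" t] Union_planted_forest[of P "V - R"]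
    by (auto simp: planted_trees_def)
  \<comment> \<open>Needed to split the product over \<open>insert t P\<close>; components inject
    into the subsets of \<open>V\<close> through their label sets.\<close>
  have finP: "finite P" if "P \<in> planted_forests_on (V - S)" for P S
  proof (rule finite_imageD)
    have "set_planted ` P \<subseteq> Pow V"
      using Union_planted_forest[OF that] by blast
    then show "finite (set_planted ` P)"
      using assms(2) by (auto intro: finite_subset)
    show "inj_on set_planted P"
      using that by (simp add: planted_forests_on_def)
  qed
  have "F x y \<alpha> \<beta> (insert m V)
      = subset_conv (\<lambda>S. sum (planted_weight x y \<alpha> \<beta>) (planted_trees (insert m S))) (F x y \<alpha> \<beta>) V"
    unfolding F_def planted_forests_on_insert[OF m]
  proof (rule sum_image_Sigma_eq_subset_conv)
    show "inj_on (\<lambda>(S, t, P). insert t P) ?A"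
    proof (rule inj_onI, clarsimp)
      fix S t P S' t' P'
      assume t: "t \<in> planted_trees (insert m S)" "t' \<in> planted_trees (insert m S')"
        and P: "P \<in> planted_forests_on (V - S)" "P' \<in> planted_forests_on (V - S')"
        and SV: "S \<subseteq> V" "S' \<subseteq> V"
        and eq: "insert t P = insert t' P'"
      have "t = t'"
        using new[OF t(1) P(2)] new[OF t(2) P(1)] eq by blast
      moreover have "insert m S = insert m S'"
        using t planted_on_set_planted \<open>t = t'\<close> unfolding planted_trees_def by blast
      moreover have "m \<notin> S" "m \<notin> S'" "t \<notin> P" "t' \<notin> P'"
        using m SV new[OF t(1) P(1)] new[OF t(2) P(2)] by auto
      ultimately show "S = S' \<and> t = t' \<and> P = P'"
        using eq by (simp add: insert_ident)
    qed
    fix S t P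
    assume "S \<subseteq> V" "t \<in> planted_trees (insert m S)" "P \<in> planted_forests_on (V - S)"
    then show "forest_weight x y \<alpha> \<beta> (case (S, t, P) of (S, t, P) \<Rightarrow> insert t P)
        = planted_weight x y \<alpha> \<beta> t * forest_weight x y \<alpha> \<beta> P"
      using new finP by (simp add: forest_weight_def)
  qed (use assms(2) sub in \<open>auto intro: finite_planted_trees_insert finite_planted_forests_on\<close>)
  also have "\<dots> = subset_conv (\<lambda>S. (\<alpha> + \<beta>) * leaf_sum x y S) (F x y \<alpha> \<beta>) V"
    using sub by (intro subset_conv_cong) (auto intro: sum_planted_trees_insert)
  finally show ?thesis by (simp add: subset_conv_scale_left)
qed

text \<open>Both sides equal 1 at the empty set and obey the same recursion, which determines them
  on all finite sets.\<close>

lemma subset_conv_leaf_sums_eq_sum_forests: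
  "finite V \<Longrightarrow> subset_conv (leaf_sum_a x y \<alpha>) (leaf_sum_b x y \<beta>) V
     = sum (forest_weight x y \<alpha> \<beta>) (planted_forests_on V)"
proof (induction V rule: finite_min_induct)
  case empty
  then show ?case
    by (simp add: leaf_sum_a_def leaf_sum_b_def leaf_weight_a_simps leaf_weight_b_simps
        forest_weight_def)
next
  case (insert m V)
  have "subset_conv (leaf_sum x y) (subset_conv (leaf_sum_a x y \<alpha>) (leaf_sum_b x y \<beta>)) V
      = subset_conv (leaf_sum x y) (\<lambda>A. sum (forest_weight x y \<alpha> \<beta>) (planted_forests_on A)) V"
    by (intro subset_conv_cong refl insert.IH)
  then show ?case
    using insert.hyps by (simp add: subset_conv_leaf_sums_insert sum_planted_forests_on_insert)
qed

theorem theorem3p2: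
  fixes x y \<alpha> \<beta> :: "'k::field_char_0" and n :: nat
  assumes "n \<ge> 1"
  shows "(\<Sum>T\<in>increasing_binary_trees n.
            (x * y) ^ num_M T * ((x + y) / 2) ^ (n - 2 * num_M T - 1)
              * \<alpha> ^ num_alpha T * \<beta> ^ num_beta T)
       = (\<Sum>P\<in>planted_forests_on {2..n}. forest_weight x y \<alpha> \<beta> P)"
proof -
  let ?w = "\<lambda>T::nat tree. (x * y) ^ num_M T * ((x + y) / 2) ^ (size T - 2 * num_M T - 1)
              * \<alpha> ^ num_alpha T * \<beta> ^ num_beta T"
  \<comment> \<open>The root carries the label 1, and \<open>{2..n}\<close> is shared between its
    two subtrees.\<close>
  have trees: "increasing_binary_trees n = heap_trees (insert 1 {2..n})"
  proof -
    have "{1..n} = insert 1 {2..n}" using assms by auto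
    then show ?thesis by (simp add: increasing_binary_trees_def heap_trees_def)
  qed
  \<comment> \<open>Writing \<open>size T\<close> for \<open>n\<close> makes the summand a function
    of the tree alone.\<close>
  have "size T = n" if "T \<in> increasing_binary_trees n" for T
    using that distinct_card[of "inorder T"]
    by (simp add: increasing_binary_trees_def set_inorder length_inorder)
  then have "(\<Sum>T\<in>increasing_binary_trees n.
            (x * y) ^ num_M T * ((x + y) / 2) ^ (n - 2 * num_M T - 1)
              * \<alpha> ^ num_alpha T * \<beta> ^ num_beta T) = sum ?w (increasing_binary_trees n)"
    by (intro sum.cong) auto
  also have "\<dots> = subset_conv (leaf_sum_a x y \<alpha>) (leaf_sum_b x y \<beta>) {2..n}"
    unfolding trees leaf_sum_a_def leaf_sum_b_def
    \<comment> \<open>\<open>simp only\<close> keeps the size of the node from being rewritten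
      before \<open>tree_weight_Node\<close> matches.\<close>
    by (rule sum_heap_trees_insert) (auto simp only: tree_weight_Node, auto)
  also have "\<dots> = (\<Sum>P\<in>planted_forests_on {2..n}. forest_weight x y \<alpha> \<beta> P)"
    by (rule subset_conv_leaf_sums_eq_sum_forests) simp
  finally show ?thesis .
qed

end
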